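(* Let $1\le p<\infty$ and $W\in\mathbb{W}$, and let $\mathbf{1}_i=\mathbf{1}_{(i-1,i]}$ for $i\in\mathbb{N}$. Then for every $\epsilon>0$ the sequence $(\mathbf{1}_i)_{i=1}^\infty$ in $G_{W,p}(0,\infty)$ admits a normalized constant-coefficient block basic sequence, i.e. $x_j=\sum_{n=k_j}^{k_{j+1}-1}\mathbf{1}_n/\|\sum_{n=k_j}^{k_{j+1}-1}\mathbf{1}_n\|_G$ for some $1=k_1<k_2<\cdots$, which is $(1+\epsilon)$-equivalent to the unit vector basis of $\ell_p$ and whose closed linear span is 2-complemented in the closed linear span $[\mathbf{1}_i]_{i=1}^\infty$.
   Context: $\lambda$ is Lebesgue measure on $(0,\infty)$ with its usual order, $\Lambda$ the Lebesgue-measurable subsets. For $E,F\in\Lambda$, $\mathbb{MO}(E,F)$ is the set of strictly increasing bijections $m:E\to F$ with $m,m^{-1}$ measure-preserving. $\mathbb{W}$ is the set of nonincreasing measurable $W:(0,\infty)\to(0,\infty)$ with $\lim_{t\to\infty}W(t)=0$, $\int_0^\infty W=\infty$, $\int_0^1W<\infty$. $\|f\|_G=\sup\{(\int_E|f\circ m|(t)^pW(t)\,dt)^{1/p}:E,F\in\Lambda,\ m\in\mathbb{MO}(E,F)\}$ and $G_{W,p}(0,\infty)$ is the space of a.e.-classes of measurable $f$ with $\|f\|_G<\infty$. Sequences $(x_j)$, $(y_j)$ are $C$-equivalent if $C^{-1}\|\sum a_jy_j\|\le\|\sum a_jx_j\|\le C\|\sum a_jy_j\|$ for some such normalization with constant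 product $C$, for all finitely supported scalars. *)

theory Defs
  imports "HOL-Analysis.Analysis"
begin

definition Lam :: "real set set" where
  "Lam = {E. E \<in> sets lebesgue \<and> E \<subseteq> {0<..}}"

definition MO :: "real set \<Rightarrow> real set \<Rightarrow> (real \<Rightarrow> real) set" where
  "MO E F = {m. strict_mono_on E m \<and> bij_betw m E F
      \<and> (\<forall>A. A \<subseteq> E \<longrightarrow> A \<in> sets lebesgue \<longrightarrow>
             m ` A \<in> sets lebesgue \<and> emeasure lebesgue (m ` A) = emeasure lebesgue A)
      \<and> (\<forall>B. B \<subseteq> F \<longrightarrow> B \<in> sets lebesgue \<longrightarrow>
             inv_into E m ` B \<in> sets lebesgue \<and>
             emeasure lebesgue (inv_into E m ` B) = emeasure lebesgue B)}"

definition Wclass :: "(real \<Rightarrow> real) set" where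
  "Wclass = {W. W \<in> borel_measurable (restrict_space lebesgue {0<..})
      \<and> (\<forall>t>0. W t > 0)
      \<and> (\<forall>s t. 0 < s \<longrightarrow> s \<le> t \<longrightarrow> W t \<le> W s)
      \<and> (W \<longlongrightarrow> 0) at_top
      \<and> (\<integral>\<^sup>+ t\<in>{0<..}. ennreal (W t) \<partial>lebesgue) = \<infinity>
      \<and> (\<integral>\<^sup>+ t\<in>{0<..1}. ennreal (W t) \<partial>lebesgue) < \<infinity>}"

definition Gsup :: "(real \<Rightarrow> real) \<Rightarrow> real \<Rightarrow> (real \<Rightarrow> real) \<Rightarrow> ennreal" where
  "Gsup W p f = Sup {(\<integral>\<^sup>+ t\<in>E. ennreal (\<bar>f (m t)\<bar> powr p * W t) \<partial>lebesgue)
                     | E F m. E \<in> Lam \<and> F \<in> Lam \<and> m \<in> MO E F}"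

text \<open>The space G_{W,p}(0,\<infinity>) (representatives; functions are only looked at on (0,\<infinity>)).\<close>
definition Gspace :: "(real \<Rightarrow> real) \<Rightarrow> real \<Rightarrow> (real \<Rightarrow> real) set" where
  "Gspace W p = {f. f \<in> borel_measurable (restrict_space lebesgue {0<..}) \<and> Gsup W p f < \<infinity>}"

definition Gnorm :: "(real \<Rightarrow> real) \<Rightarrow> real \<Rightarrow> (real \<Rightarrow> real) \<Rightarrow> real" where
  "Gnorm W p f = (enn2real (Gsup W p f)) powr (1 / p)"

definition Gclspan :: "(real \<Rightarrow> real) \<Rightarrow> real \<Rightarrow> (nat \<Rightarrow> real \<Rightarrow> real) \<Rightarrow> (real \<Rightarrow> real) set" where
  "Gclspan W p v = {f \<in> Gspace W p. \<forall>e>0. \<exists>n c.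
        Gnorm W p (\<lambda>t. f t - (\<Sum>j<n. c j * v j t)) < e}"

definition unitind :: "nat \<Rightarrow> real \<Rightarrow> real" where
  "unitind i = indicator {real i - 1<..real i}"

definition lp_equiv :: "(real \<Rightarrow> real) \<Rightarrow> real \<Rightarrow> (nat \<Rightarrow> real \<Rightarrow> real) \<Rightarrow> real \<Rightarrow> bool" where
  "lp_equiv W p x C \<longleftrightarrow> (\<exists>A B. 0 < A \<and> 0 < B \<and> A * B \<le> C \<and>
      (\<forall>n (a :: nat \<Rightarrow> real).
         (1 / A) * (\<Sum>j<n. \<bar>a j\<bar> powr p) powr (1 / p) \<le> Gnorm W p (\<lambda>t. \<Sum>j<n. a j * x j t)
       \<and> Gnorm W p (\<lambda>t. \<Sum>j<n. a j * x j t) \<le> B * (\<Sum>j<n. \<bar>a j\<bar> powr p) powr (1 / p)))"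

definition Gcomplemented :: "(real \<Rightarrow> real) \<Rightarrow> real \<Rightarrow> (real \<Rightarrow> real) set \<Rightarrow> (real \<Rightarrow> real) set \<Rightarrow> real \<Rightarrow> bool" where
  "Gcomplemented W p Y X K \<longleftrightarrow> (\<exists>P. (\<forall>f\<in>X. P f \<in> Y)
      \<and> (\<forall>f\<in>Y. Gnorm W p (\<lambda>t. P f t - f t) = 0)
      \<and> (\<forall>f\<in>X. \<forall>g\<in>X. \<forall>a b. Gnorm W p (\<lambda>t. P (\<lambda>s. a * f s + b * g s) t - (a * P f t + b * P g t)) = 0)
      \<and> (\<forall>f\<in>X. Gnorm W p (P f) \<le> K * Gnorm W p f))"

end

theory Submission
  imports Defs
begin

text \<open>
  Disjoint constant blocks satisfy an upper \<open>\<ell>\<^sub>p\<close> estimate with constant 1, because the sum of the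
  integrals over \<open>m -` J\<^sub>j\<close> is at most the sum of the separate suprema. For a lower estimate the choice
  \<open>m = id\<close> suffices once the \<open>p\<close>-th power of the norm of the indicator of \<open>J\<^sub>j\<close> is
  at most \<open>q\<close> times the integral of \<open>W\<close> over \<open>J\<^sub>j\<close>; since \<open>W\<close> is not integrable, this holds
  for any \<open>q > 1\<close> if every block is so long that its \<open>W\<close>-mass dwarfs the mass of all earlier blocks. The projection replaces
  \<open>f\<close> on \<open>J\<^sub>j\<close> by its average with respect to \<open>W dt\<close> (not \<open>dt\<close>); by Jensen's inequality and the same
  two estimates its norm is at most \<open>q\<^bsup>1/p\<^esup>\<close>.
\<close>

section \<open>Elementary inequalities for p-th powers\<close>

text \<open>The tangent line at 1 of the convex function \<open>x powr p\<close>, solved for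
  \<open>x\<close>. It is Young's inequality for \<open>x powr p\<close> and 1 with weights
  \<open>1 / p\<close> and \<open>1 - 1 / p\<close>.\<close>

lemma le_powr_tangent:
  fixes x p :: real
  assumes "1 \<le> p" "0 \<le> x"
  shows "x \<le> x powr p / p + (1 - 1 / p)"
proof (cases "x = 0")
  case False
  have "x = (x powr p) powr (1 / p) * 1 powr (1 - 1 / p)"
    using assms False by (simp add: powr_powr)
  also have "\<dots> \<le> (1 / p) * x powr p + (1 - 1 / p) * 1"
    by (rule Youngs_inequality_0) (use assms False in auto)
  finally show ?thesis by simp
qed (use assms in simp)

text \<open>Jensen's inequality for the p-th power, obtained by integrating the tangent inequality
  at the absolute value \<open>c\<close> of the mean. Scaling by \<open>c\<close> moves the point of
  tangency to 1, which is why \<open>c = 0\<close> is a separate case.\<close>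

lemma average_powr_le:
  fixes f :: "'a \<Rightarrow> real"
  assumes p: "1 \<le> p" and A: "A \<in> sets M" "emeasure M A < \<infinity>" "0 < measure M A"
    and f: "set_integrable M A f" and fp: "set_integrable M A (\<lambda>x. \<bar>f x\<bar> powr p)"
  shows "\<bar>(LINT x:A|M. f x) / measure M A\<bar> powr p * measure M A \<le> (LINT x:A|M. \<bar>f x\<bar> powr p)"
proof -
  define c where "c = \<bar>(LINT x:A|M. f x) / measure M A\<bar>"
  show ?thesis
  proof (cases "c = 0")
    case True
    have "0 \<le> (LINT x:A|M. \<bar>f x\<bar> powr p)"
      unfolding set_lebesgue_integral_def by (rule integral_nonneg_AE) auto
    then show ?thesis unfolding c_def[symmetric] using True by simp
  next
    case False
    then have c: "c > 0" unfolding c_def by linarith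
    have abs: "set_integrable M A (\<lambda>x. \<bar>f x\<bar>)"
      using f by (rule set_integrable_abs)
    have one: "set_integrable M A (\<lambda>x. 1)"
      using A by (simp add: set_integrable_def)
    \<comment> \<open>The function is the tangent bound at \<open>\<bar>f x\<bar> / c\<close>,
      multiplied by \<open>c\<close> and arranged so that linearity computes its integral. The
      factor \<open>c powr - p / p\<close> is \<open>c powr (- p)\<close> divided by
      \<open>p\<close>.\<close>
    have rhs: "set_integrable M A (\<lambda>x. (\<bar>f x\<bar> powr p * (c powr - p / p) + (1 - 1 / p) * 1) * c)"
      by (intro set_integrable_mult_left set_integrable_mult_right set_integral_add fp one)
    have "c * measure M A = \<bar>LINT x:A|M. f x\<bar>"
      using A unfolding c_def by (simp add: abs_divide)
    also have "\<dots> \<le> (LINT x:A|M. \<bar>f x\<bar>)"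
      using set_integral_norm_bound[OF f] by simp
    also have "\<dots> \<le> (LINT x:A|M. (\<bar>f x\<bar> powr p * (c powr - p / p) + (1 - 1 / p) * 1) * c)"
    proof (rule set_integral_mono[OF abs rhs])
      fix x
      have "\<bar>f x\<bar> / c \<le> (\<bar>f x\<bar> / c) powr p / p + (1 - 1 / p)"
        by (rule le_powr_tangent) (use p c in auto)
      also have "(\<bar>f x\<bar> / c) powr p = \<bar>f x\<bar> powr p * c powr - p"
        using c by (simp add: powr_divide powr_minus divide_simps)
      finally show "\<bar>f x\<bar> \<le> (\<bar>f x\<bar> powr p * (c powr - p / p) + (1 - 1 / p) * 1) * c"
        using c by (simp add: field_simps)
    qed
    also have "\<dots> = ((LINT x:A|M. \<bar>f x\<bar> powr p) * (c powr - p / p) + (1 - 1 / p) * measure M A) * c"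
      using A by (simp add: set_integral_mult_left set_integral_mult_right set_integral_add fp one
          set_lebesgue_integral_def[of M A "\<lambda>_. 1"]
          set_integrable_mult_left set_integrable_mult_right
          left_diff_distrib)
    finally have "measure M A \<le> (LINT x:A|M. \<bar>f x\<bar> powr p) * (c powr - p / p) + (1 - 1 / p) * measure M A"
      using c by simp
    \<comment> \<open>Moving the constant term to the left leaves just the fraction
      \<open>1 / p\<close> of the measure there.\<close>
    then have "measure M A / p \<le> (LINT x:A|M. \<bar>f x\<bar> powr p) * c powr - p / p"
      using p by (simp add: algebra_simps)
    then have "measure M A / p * p \<le> (LINT x:A|M. \<bar>f x\<bar> powr p) * c powr - p / p * p"
      by (rule mult_right_mono) (use p in simp)
    then have "measure M A \<le> (LINT x:A|M. \<bar>f x\<bar> powr p) / c powr p"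
      using p by (simp add: powr_minus_divide)
    then show ?thesis
      unfolding c_def[symmetric] using c by (simp add: field_simps)
  qed
qed

text \<open>A crude substitute for Minkowski's inequality. The constant \<open>2 powr p\<close> is
  harmless because sums are estimated only to show that something is finite or tends to 0.\<close>

lemma abs_add_powr_le:
  fixes a b p :: real
  assumes "0 \<le> p"
  shows "\<bar>a + b\<bar> powr p \<le> 2 powr p * (\<bar>a\<bar> powr p + \<bar>b\<bar> powr p)"
proof -
  have "\<bar>a + b\<bar> powr p \<le> (2 * max \<bar>a\<bar> \<bar>b\<bar>) powr p"
    by (rule powr_mono2) (use assms in auto)
  also have "\<dots> = 2 powr p * (max \<bar>a\<bar> \<bar>b\<bar>) powr p"
    by (simp add: powr_mult)
  also have "(max \<bar>a\<bar> \<bar>b\<bar>) powr p \<le> \<bar>a\<bar> powr p + \<bar>b\<bar> powr p"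
    by (simp add: max_def)
  finally show ?thesis by simp
qed

section \<open>Order-preserving rearrangements and composition with them\<close>

lemma MO_bij_betw: "m \<in> MO E F \<Longrightarrow> bij_betw m E F"
  unfolding MO_def by (elim CollectE conjE)

lemma MO_inv_image:
  assumes "m \<in> MO E F" "B \<subseteq> F" "B \<in> sets lebesgue"
  shows "inv_into E m ` B \<in> sets lebesgue" and "emeasure lebesgue (inv_into E m ` B) = emeasure lebesgue B"
proof -
  have "\<forall>B. B \<subseteq> F \<longrightarrow> B \<in> sets lebesgue \<longrightarrow> inv_into E m ` B \<in> sets lebesgue \<and>
      emeasure lebesgue (inv_into E m ` B) = emeasure lebesgue B"
    using assms(1) unfolding MO_def by (elim CollectE conjE)
  then show "inv_into E m ` B \<in> sets lebesgue" "emeasure lebesgue (inv_into E m ` B) = emeasure lebesgue B"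
    using assms(2,3) by blast+
qed

lemma MO_inv_image_eq:
  assumes "bij_betw m E F"
  shows "inv_into E m ` (A \<inter> F) = {t \<in> E. m t \<in> A}"
proof (intro equalityI subsetI)
  fix x assume "x \<in> inv_into E m ` (A \<inter> F)"
  then show "x \<in> {t \<in> E. m t \<in> A}"
    using assms by (auto simp: bij_betw_def f_inv_into_f inv_into_into)
next
  fix x assume "x \<in> {t \<in> E. m t \<in> A}"
  then show "x \<in> inv_into E m ` (A \<inter> F)"
    using assms by (intro image_eqI[of _ _ "m x"]) (auto simp: bij_betw_def)
qed

text \<open>Measurability comes from the half of \<open>MO\<close> that concerns the inverse: the
  preimage of \<open>A\<close> is the image of \<open>A \<inter> F\<close> under
  \<open>inv_into E m\<close>.\<close>

lemma MO_measurable: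
  assumes "m \<in> MO E F" "E \<in> Lam" "F \<in> Lam"
  shows "m \<in> measurable (restrict_space lebesgue E) (restrict_space lebesgue {0<..})"
proof (rule measurableI)
  fix x assume "x \<in> space (restrict_space lebesgue E)"
  then show "m x \<in> space (restrict_space lebesgue {0<..})"
    using assms(2,3) bij_betw_apply[OF MO_bij_betw[OF assms(1)]] by (auto simp: Lam_def space_restrict_space)
next
  fix A :: "real set" assume "A \<in> sets (restrict_space lebesgue {0<..})"
  then have A: "A \<in> sets lebesgue" by (auto simp: sets_restrict_space)
  have "A \<inter> F \<in> sets lebesgue" using A assms by (auto simp: Lam_def)
  then have "inv_into E m ` (A \<inter> F) \<in> sets lebesgue"
    by (intro MO_inv_image[OF assms(1)]) auto
  then have "{t \<in> E. m t \<in> A} \<in> sets lebesgue"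
    unfolding MO_inv_image_eq[OF MO_bij_betw[OF assms(1)]] .
  also have "{t \<in> E. m t \<in> A} = m -` A \<inter> E" by auto
  finally have "m -` A \<inter> E \<in> sets lebesgue" .
  then show "m -` A \<inter> space (restrict_space lebesgue E) \<in> sets (restrict_space lebesgue E)"
    using assms(2) by (auto simp: sets_restrict_space_iff space_restrict_space Lam_def)
qed

lemma id_in_MO: "(\<lambda>t. t) \<in> MO E E"
proof -
  have "inv_into E (\<lambda>t. t) ` B = B" if "B \<subseteq> E" for B
    using that inv_into_f_f[of "\<lambda>t. t" E] by (force simp: image_iff subset_iff)
  then show ?thesis by (auto simp: MO_def strict_mono_on_def bij_betw_def)
qed

text \<open>The composition of \<open>f\<close> with \<open>m\<close>, extended by 0 off
  \<open>E\<close>. All rearrangements of \<open>f\<close> thus become functions on the whole line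
  that can be integrated against one fixed measure.\<close>

definition pull :: "(real \<Rightarrow> real) \<Rightarrow> real set \<Rightarrow> (real \<Rightarrow> real) \<Rightarrow> real \<Rightarrow> real" where
  "pull m E f = (\<lambda>t. indicator E t * f (m t))"

lemma pull_measurable:
  assumes "m \<in> MO E F" "E \<in> Lam" "F \<in> Lam"
    and "f \<in> borel_measurable (restrict_space lebesgue {0<..})"
  shows "pull m E f \<in> borel_measurable lebesgue"
  using measurable_compose[OF MO_measurable[OF assms(1-3)] assms(4)] assms(2)
  unfolding pull_def Lam_def by (simp add: borel_measurable_restrict_space_iff)

section \<open>The weighted measure and the supremum defining the norm\<close>

locale weight =
  fixes p :: real and W :: "real \<Rightarrow> real"
  assumes p_ge_1: "1 \<le> p" and W_in_Wclass: "W \<in> Wclass"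
begin

text \<open>The measure \<open>W dt\<close> on the positive half-line. The indicator cuts off the
  nonpositive reals, on which \<open>Wclass\<close> does not constrain the values of
  \<open>W\<close>.\<close>

definition nu :: "real measure" where
  "nu = density lebesgue (\<lambda>t. ennreal (W t) * indicator {0<..} t)"

lemma W_measurable [measurable]:
  "(\<lambda>t. ennreal (W t) * indicator {0<..} t) \<in> borel_measurable lebesgue"
proof -
  have "(\<lambda>t. ennreal (W t)) \<in> borel_measurable (restrict_space lebesgue {0<..})"
    using W_in_Wclass unfolding Wclass_def by (auto intro: measurable_compose)
  then show ?thesis by (simp add: borel_measurable_restrict_space_iff_ennreal)
qed

lemma sets_nu [simp, measurable_cong]: "sets nu = sets lebesgue"
  and space_nu [simp]: "space nu = UNIV"
  unfolding nu_def by simp_all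

lemma W_mono: "0 < s \<Longrightarrow> s \<le> t \<Longrightarrow> W t \<le> W s"
  and W_pos: "0 < t \<Longrightarrow> 0 < W t"
  using W_in_Wclass unfolding Wclass_def by auto

lemma nn_integral_pull:
  assumes "m \<in> MO E F" "E \<in> Lam" "F \<in> Lam"
    and "f \<in> borel_measurable (restrict_space lebesgue {0<..})"
  shows "(\<integral>\<^sup>+ t\<in>E. ennreal (\<bar>f (m t)\<bar> powr p * W t) \<partial>lebesgue)
    = (\<integral>\<^sup>+ t. ennreal (\<bar>pull m E f t\<bar> powr p) \<partial>nu)"
proof -
  have [measurable]: "pull m E f \<in> borel_measurable lebesgue"
    using pull_measurable[OF assms] .
  have "(\<integral>\<^sup>+ t. ennreal (\<bar>pull m E f t\<bar> powr p) \<partial>nu)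
     = (\<integral>\<^sup>+ t. ennreal (W t) * indicator {0<..} t * ennreal (\<bar>pull m E f t\<bar> powr p) \<partial>lebesgue)"
    unfolding nu_def by (rule nn_integral_density) measurable
  also have "\<dots> = (\<integral>\<^sup>+ t\<in>E. ennreal (\<bar>f (m t)\<bar> powr p * W t) \<partial>lebesgue)"
    using assms(2) W_pos
    by (intro nn_integral_cong)
       (auto simp: pull_def Lam_def indicator_def ennreal_mult less_imp_le mult.commute)
  finally show ?thesis by simp
qed

lemma pull_le_Gsup:
  assumes "m \<in> MO E F" "E \<in> Lam" "F \<in> Lam"
    and "f \<in> borel_measurable (restrict_space lebesgue {0<..})"
  shows "(\<integral>\<^sup>+ t. ennreal (\<bar>pull m E f t\<bar> powr p) \<partial>nu) \<le> Gsup W p f"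
  unfolding nn_integral_pull[OF assms, symmetric] Gsup_def
  by (rule Sup_upper) (use assms in blast)

lemma Gsup_le:
  assumes "f \<in> borel_measurable (restrict_space lebesgue {0<..})"
    and "\<And>E F m. m \<in> MO E F \<Longrightarrow> E \<in> Lam \<Longrightarrow> F \<in> Lam \<Longrightarrow>
      (\<integral>\<^sup>+ t. ennreal (\<bar>pull m E f t\<bar> powr p) \<partial>nu) \<le> C"
  shows "Gsup W p f \<le> C"
  unfolding Gsup_def
proof (rule Sup_least, elim CollectE exE conjE)
  fix c E F m
  assume c: "c = (\<integral>\<^sup>+ t\<in>E. ennreal (\<bar>f (m t)\<bar> powr p * W t) \<partial>lebesgue)"
    and m: "E \<in> Lam" "F \<in> Lam" "m \<in> MO E F"
  show "c \<le> C"
    unfolding c nn_integral_pull[OF m(3,1,2) assms(1)] by (rule assms(2)[OF m(3,1,2)])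
qed

text \<open>The identity of the half-line is one of the competitors in the supremum. Every lower
  bound for \<open>Gsup\<close> below goes back to this.\<close>

lemma nn_integral_le_Gsup:
  assumes "f \<in> borel_measurable (restrict_space lebesgue {0<..})"
  shows "(\<integral>\<^sup>+ t\<in>{0<..}. ennreal (\<bar>f t\<bar> powr p) \<partial>nu) \<le> Gsup W p f"
proof -
  have "(\<integral>\<^sup>+ t\<in>{0<..}. ennreal (\<bar>f t\<bar> powr p) \<partial>nu)
     = (\<integral>\<^sup>+ t. ennreal (\<bar>pull (\<lambda>t. t) {0<..} f t\<bar> powr p) \<partial>nu)"
    using p_ge_1 by (intro nn_integral_cong) (auto simp: pull_def indicator_def)
  also have "\<dots> \<le> Gsup W p f"
    by (rule pull_le_Gsup[OF id_in_MO _ _ assms]) (auto simp: Lam_def)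
  finally show ?thesis .
qed

lemma Gsup_add_le:
  assumes f: "f \<in> borel_measurable (restrict_space lebesgue {0<..})"
    and g: "g \<in> borel_measurable (restrict_space lebesgue {0<..})"
  shows "Gsup W p (\<lambda>t. f t + g t) \<le> ennreal (2 powr p) * (Gsup W p f + Gsup W p g)"
proof (rule Gsup_le)
  fix E F m assume m: "m \<in> MO E F" "E \<in> Lam" "F \<in> Lam"
  note [measurable] = pull_measurable[OF m f] pull_measurable[OF m g]
  have "(\<integral>\<^sup>+ t. ennreal (\<bar>pull m E (\<lambda>t. f t + g t) t\<bar> powr p) \<partial>nu)
    \<le> (\<integral>\<^sup>+ t. ennreal (2 powr p) * (ennreal (\<bar>pull m E f t\<bar> powr p) + ennreal (\<bar>pull m E g t\<bar> powr p)) \<partial>nu)"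
  proof (rule nn_integral_mono)
    fix t
    have "\<bar>pull m E (\<lambda>t. f t + g t) t\<bar> powr p
       \<le> 2 powr p * (\<bar>pull m E f t\<bar> powr p + \<bar>pull m E g t\<bar> powr p)"
      unfolding pull_def distrib_left[of "indicator E t"] by (rule abs_add_powr_le) (use p_ge_1 in simp)
    then show "ennreal (\<bar>pull m E (\<lambda>t. f t + g t) t\<bar> powr p)
       \<le> ennreal (2 powr p) * (ennreal (\<bar>pull m E f t\<bar> powr p) + ennreal (\<bar>pull m E g t\<bar> powr p))"
      by (simp add: ennreal_leI flip: ennreal_mult ennreal_plus)
  qed
  also have "\<dots> = ennreal (2 powr p) * ((\<integral>\<^sup>+ t. ennreal (\<bar>pull m E f t\<bar> powr p) \<partial>nu)
      + (\<integral>\<^sup>+ t. ennreal (\<bar>pull m E g t\<bar> powr p) \<partial>nu))"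
    by (simp add: nn_integral_cmult nn_integral_add)
  also have "\<dots> \<le> ennreal (2 powr p) * (Gsup W p f + Gsup W p g)"
    by (intro mult_left_mono add_mono pull_le_Gsup[OF m] f g) auto
  finally show "(\<integral>\<^sup>+ t. ennreal (\<bar>pull m E (\<lambda>t. f t + g t) t\<bar> powr p) \<partial>nu)
    \<le> ennreal (2 powr p) * (Gsup W p f + Gsup W p g)" .
qed (use f g in measurable)

lemma Gsup_cmult:
  assumes f: "f \<in> borel_measurable (restrict_space lebesgue {0<..})"
  shows "Gsup W p (\<lambda>t. c * f t) \<le> ennreal (\<bar>c\<bar> powr p) * Gsup W p f"
proof (rule Gsup_le)
  fix E F m assume m: "m \<in> MO E F" "E \<in> Lam" "F \<in> Lam"
  note [measurable] = pull_measurable[OF m f]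
  have "(\<integral>\<^sup>+ t. ennreal (\<bar>pull m E (\<lambda>t. c * f t) t\<bar> powr p) \<partial>nu)
    = (\<integral>\<^sup>+ t. ennreal (\<bar>c\<bar> powr p) * ennreal (\<bar>pull m E f t\<bar> powr p) \<partial>nu)"
    by (intro nn_integral_cong)
       (auto simp: pull_def abs_mult powr_mult ennreal_mult' indicator_def)
  also have "\<dots> = ennreal (\<bar>c\<bar> powr p) * (\<integral>\<^sup>+ t. ennreal (\<bar>pull m E f t\<bar> powr p) \<partial>nu)"
    by (subst nn_integral_cmult) measurable
  also have "\<dots> \<le> ennreal (\<bar>c\<bar> powr p) * Gsup W p f"
    by (intro mult_left_mono pull_le_Gsup[OF m] f) auto
  finally show "(\<integral>\<^sup>+ t. ennreal (\<bar>pull m E (\<lambda>t. c * f t) t\<bar> powr p) \<partial>nu) \<le> ennreal (\<bar>c\<bar> powr p) * Gsup W p f" .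
qed (use f in measurable)

text \<open>Finiteness matters: \<open>enn2real\<close> sends infinity to 0, so a function outside
  the space has \<open>Gnorm\<close> equal to 0.\<close>

lemma Gnorm_powr:
  assumes "Gsup W p f < \<infinity>"
  shows "ennreal (Gnorm W p f powr p) = Gsup W p f"
  using assms p_ge_1 unfolding Gnorm_def by (simp add: powr_powr)

section \<open>Masses of intervals and norms of indicators\<close>

lemma emeasure_nu:
  assumes "A \<in> sets lebesgue"
  shows "emeasure nu A = (\<integral>\<^sup>+ t\<in>A. ennreal (W t) * indicator {0<..} t \<partial>lebesgue)"
  unfolding nu_def by (rule emeasure_density) (use assms in measurable)

lemma emeasure_nu_pos:
  assumes "A \<in> sets lebesgue" "A \<subseteq> {0<..}"
  shows "emeasure nu A = (\<integral>\<^sup>+ t\<in>A. ennreal (W t) \<partial>lebesgue)"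
  using assms by (auto simp: emeasure_nu indicator_def intro!: nn_integral_cong)

lemma nu_interval_finite: "emeasure nu {0<..real n} < \<infinity>"
proof -
  \<comment> \<open>Split at 1: near 0 the integrability in \<open>Wclass\<close> applies, and
    beyond 1 monotonicity bounds \<open>W\<close> by \<open>W 1\<close>.\<close>
  have "emeasure nu {0<..real n} \<le> emeasure nu ({0<..1} \<union> {1<..real n})"
    by (rule emeasure_mono) auto
  also have "\<dots> \<le> emeasure nu {0<..1} + emeasure nu {1<..real n}"
    by (rule emeasure_subadditive) auto
  also have "emeasure nu {0<..1} = (\<integral>\<^sup>+ t\<in>{0<..1}. ennreal (W t) \<partial>lebesgue)"
    by (rule emeasure_nu_pos) auto
  also have "emeasure nu {1<..real n} = (\<integral>\<^sup>+ t\<in>{1<..real n}. ennreal (W t) * indicator {0<..} t \<partial>lebesgue)"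
    by (rule emeasure_nu) simp
  also have "\<dots> \<le> (\<integral>\<^sup>+ t. ennreal (W 1) * indicator {1<..real n} t \<partial>lebesgue)"
    by (intro nn_integral_mono) (auto simp: indicator_def intro!: ennreal_leI W_mono)
  also have "\<dots> = ennreal (W 1) * emeasure lebesgue {1<..real n}"
    by (rule nn_integral_cmult_indicator) simp
  also have "\<dots> < \<infinity>"
    by (cases "1 \<le> real n") (auto simp: ennreal_mult_less_top)
  finally show ?thesis
    using W_in_Wclass unfolding Wclass_def by (auto simp: add_left_mono less_top)
qed

lemma nu_unbounded: "(\<lambda>n. emeasure nu {0<..real n}) \<longlonglongrightarrow> \<infinity>"
proof -
  have "(\<lambda>n. emeasure nu {0<..real n}) \<longlonglongrightarrow> emeasure nu (\<Union>n. {0<..real n})"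
    by (rule Lim_emeasure_incseq) (auto simp: incseq_def)
  also have "(\<Union>n. {0<..real n}) = {0<..}"
    using real_arch_simple by (auto intro: less_le_trans)
  also have "emeasure nu {0<..} = (\<integral>\<^sup>+ t\<in>{0<..}. ennreal (W t) \<partial>lebesgue)"
    by (rule emeasure_nu_pos) auto
  also have "\<dots> = \<infinity>" using W_in_Wclass unfolding Wclass_def by auto
  finally show ?thesis .
qed

text \<open>Since \<open>W\<close> is nonincreasing, \<open>W N\<close> separates its values on \<open>{0<..N} - E\<close>
  from those on \<open>E - {0<..N}\<close>, and the latter set is not larger than the former.\<close>
lemma nu_le_initial_interval:
  assumes E: "E \<in> sets lebesgue" "E \<subseteq> {0<..}" and N: "0 < N"
    and le: "emeasure lebesgue E \<le> ennreal N"
  shows "emeasure nu E \<le> emeasure nu {0<..N}"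
proof -
  let ?I = "{0<..N}"
  \<comment> \<open>The common part is cancelled from both sides below, which in
    \<open>ennreal\<close> requires it to be finite.\<close>
  have fin: "emeasure lebesgue (E \<inter> ?I) \<noteq> \<infinity>"
  proof -
    have "emeasure lebesgue (E \<inter> ?I) \<le> emeasure lebesgue E"
      using E(1) by (intro emeasure_mono) auto
    also note le
    finally show ?thesis by (auto simp: top_unique)
  qed
  have "emeasure lebesgue (E \<inter> ?I) + emeasure lebesgue (E - ?I) = emeasure lebesgue E"
    using E by (subst plus_emeasure) (auto simp: Int_Diff_Un)
  also have "\<dots> \<le> emeasure lebesgue ?I" using le N by simp
  also have "\<dots> = emeasure lebesgue (E \<inter> ?I) + emeasure lebesgue (?I - E)"
    using E by (subst plus_emeasure) (auto simp: Int_commute[of E] Int_Diff_Un)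
  finally have sz: "emeasure lebesgue (E - ?I) \<le> emeasure lebesgue (?I - E)"
    using fin by simp
  have "emeasure nu (E - ?I) = (\<integral>\<^sup>+ t\<in>E - ?I. ennreal (W t) * indicator {0<..} t \<partial>lebesgue)"
    using E by (intro emeasure_nu sets.Diff) auto
  also have "\<dots> \<le> (\<integral>\<^sup>+ t. ennreal (W N) * indicator (E - ?I) t \<partial>lebesgue)"
    by (intro nn_integral_mono) (use N in \<open>auto simp: indicator_def intro!: ennreal_leI W_mono\<close>)
  also have "\<dots> = ennreal (W N) * emeasure lebesgue (E - ?I)"
    using E by (intro nn_integral_cmult_indicator sets.Diff) simp_all
  also have "\<dots> \<le> ennreal (W N) * emeasure lebesgue (?I - E)"
    using sz by (rule mult_left_mono) simp
  also have "\<dots> = (\<integral>\<^sup>+ t. ennreal (W N) * indicator (?I - E) t \<partial>lebesgue)"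
    using E by (intro nn_integral_cmult_indicator[symmetric] sets.Diff) simp_all
  also have "\<dots> \<le> (\<integral>\<^sup>+ t\<in>?I - E. ennreal (W t) * indicator {0<..} t \<partial>lebesgue)"
    by (intro nn_integral_mono) (use N in \<open>auto simp: indicator_def intro!: ennreal_leI W_mono\<close>)
  also have "\<dots> = emeasure nu (?I - E)"
    using E by (intro emeasure_nu[symmetric] sets.Diff) auto
  finally have diff: "emeasure nu (E - ?I) \<le> emeasure nu (?I - E)" .
  have "emeasure nu E = emeasure nu (E \<inter> ?I) + emeasure nu (E - ?I)"
    using E by (subst plus_emeasure) (auto simp: Int_Diff_Un)
  also have "\<dots> \<le> emeasure nu (E \<inter> ?I) + emeasure nu (?I - E)"
    using diff by (rule add_left_mono)
  also have "\<dots> = emeasure nu ?I"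
    using E by (subst plus_emeasure) (auto simp: Int_commute[of E] Int_Diff_Un)
  finally show ?thesis .
qed

text \<open>A rearrangement of an indicator is again an indicator, of the preimage \<open>D\<close>
  of \<open>J\<close>. As \<open>m\<close> preserves measure, \<open>D\<close> is not larger than
  \<open>J\<close>, so its \<open>W\<close>-mass is at most that of an initial interval of length
  \<open>N\<close>.\<close>

lemma Gsup_indicator_le:
  assumes J: "J \<in> sets lebesgue" "J \<subseteq> {0<..}" and N: "0 < N"
    and le: "emeasure lebesgue J \<le> ennreal N"
  shows "Gsup W p (indicator J) \<le> emeasure nu {0<..N}"
proof (rule Gsup_le)
  show meas: "(indicator J :: real \<Rightarrow> real) \<in> borel_measurable (restrict_space lebesgue {0<..})"
    using J by (intro measurable_restrict_space1) auto
  fix E F m assume m: "m \<in> MO E F" "E \<in> Lam" "F \<in> Lam"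
  define D where "D = inv_into E m ` (J \<inter> F)"
  have JF: "J \<inter> F \<in> sets lebesgue" using J m by (auto simp: Lam_def)
  then have D: "D \<in> sets lebesgue" "emeasure lebesgue D = emeasure lebesgue (J \<inter> F)"
    unfolding D_def using MO_inv_image[OF m(1)] by simp_all
  have Deq: "D = {t \<in> E. m t \<in> J}"
    unfolding D_def by (rule MO_inv_image_eq[OF MO_bij_betw[OF m(1)]])
  have "(\<integral>\<^sup>+ t. ennreal (\<bar>pull m E (indicator J) t\<bar> powr p) \<partial>nu) = (\<integral>\<^sup>+ t. indicator D t \<partial>nu)"
    using p_ge_1 by (intro nn_integral_cong) (auto simp: pull_def Deq indicator_def)
  also have "\<dots> = emeasure nu D" using D by simp
  also have "\<dots> \<le> emeasure nu {0<..N}"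
  proof (rule nu_le_initial_interval)
    show "D \<subseteq> {0<..}" using m Deq by (auto simp: Lam_def)
    have "emeasure lebesgue (J \<inter> F) \<le> emeasure lebesgue J"
      using J by (intro emeasure_mono) auto
    then show "emeasure lebesgue D \<le> ennreal N" using D le by simp
  qed (use D N in auto)
  finally show "(\<integral>\<^sup>+ t. ennreal (\<bar>pull m E (indicator J) t\<bar> powr p) \<partial>nu) \<le> emeasure nu {0<..N}" .
qed

lemma nu_interval_pos:
  assumes "0 \<le> a" "a < b"
  shows "0 < emeasure nu {a<..b}"
proof -
  have "0 < ennreal (W b) * emeasure lebesgue {a<..b}"
    using assms W_pos[of b] by (simp add: ennreal_zero_less_mult_iff)
  also have "\<dots> = (\<integral>\<^sup>+ t. ennreal (W b) * indicator {a<..b} t \<partial>lebesgue)"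
    by (rule nn_integral_cmult_indicator[symmetric]) simp
  also have "\<dots> \<le> (\<integral>\<^sup>+ t\<in>{a<..b}. ennreal (W t) \<partial>lebesgue)"
    by (intro nn_integral_mono) (use assms in \<open>auto simp: indicator_def intro!: ennreal_leI W_mono\<close>)
  also have "\<dots> = emeasure nu {a<..b}"
    by (rule emeasure_nu_pos[symmetric]) (use assms in auto)
  finally show ?thesis .
qed

text \<open>Write \<open>a\<close> for the mass up to \<open>m\<close> and \<open>b\<close> for the
  mass of the new interval. The claim \<open>a + b \<le> q * b\<close> means that \<open>b\<close>
  is at least \<open>a / (q - 1)\<close>, which holds for large \<open>n\<close> because
  \<open>W\<close> has infinite integral.\<close>

lemma ex_dominating_interval:
  assumes q: "1 < q"
  shows "\<exists>n>m. emeasure nu {0<..real n} \<le> ennreal q * emeasure nu {real m<..real n}"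
proof -
  define a where "a = measure nu {0<..real m}"
  have a: "emeasure nu {0<..real m} = ennreal a"
    using nu_interval_finite[of m] unfolding a_def by (simp add: emeasure_eq_ennreal_measure)
  \<comment> \<open>The threshold is for the total mass: \<open>a + b\<close> exceeds
    \<open>q * a / (q - 1)\<close> exactly when \<open>b\<close> exceeds
    \<open>a / (q - 1)\<close>.\<close>
  have "\<forall>\<^sub>F n in sequentially. ennreal (q * a / (q - 1)) < emeasure nu {0<..real n}"
    by (rule order_tendstoD(1)[OF nu_unbounded]) simp
  then have "\<forall>\<^sub>F n in sequentially. ennreal (q * a / (q - 1)) < emeasure nu {0<..real n} \<and> m < n"
    using eventually_gt_at_top by (rule eventually_conj)
  then obtain n where n: "ennreal (q * a / (q - 1)) < emeasure nu {0<..real n}" "m < n"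
    by (auto dest: eventually_happens)
  define b where "b = measure nu {real m<..real n}"
  have "emeasure nu {real m<..real n} \<le> emeasure nu {0<..real n}"
    by (rule emeasure_mono) auto
  then have b: "emeasure nu {real m<..real n} = ennreal b"
    using nu_interval_finite[of n] unfolding b_def
    by (intro emeasure_eq_ennreal_measure) (auto simp: top_unique)
  have "{0<..real n} = {0<..real m} \<union> {real m<..real n}" using n(2) by auto
  then have "emeasure nu {0<..real n} = emeasure nu {0<..real m} + emeasure nu {real m<..real n}"
    by (simp add: plus_emeasure)
  then have ab: "emeasure nu {0<..real n} = ennreal (a + b)"
    unfolding a b by (simp add: a_def b_def)
  have "q * a / (q - 1) < a + b"
    using n(1) unfolding ab using q by (simp add: a_def ennreal_less_iff)
  then have "q * a < (a + b) * (q - 1)"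
    using q by (simp add: divide_less_eq)
  then have "a + b \<le> q * b" by (simp add: algebra_simps)
  then have "ennreal (a + b) \<le> ennreal q * ennreal b"
    using q by (simp add: b_def flip: ennreal_mult)
  then show ?thesis using n(2) unfolding ab[symmetric] b[symmetric] by blast
qed

end

text \<open>Tails of a convergent series tend to 0. The tail is written by zeroing the first
  \<open>n\<close> terms instead of shifting, to match a step function whose first \<open>n\<close>
  coefficients have been removed.\<close>

lemma ennreal_suminf_tail_less:
  fixes b :: "nat \<Rightarrow> ennreal"
  assumes fin: "(\<Sum>j. b j) < \<infinity>" and e: "0 < e"
  shows "\<exists>n. (\<Sum>j. if j < n then 0 else b j) < e"
proof -
  define c where "c j = enn2real (b j)" for j
  have "b j < \<infinity>" for j
    by (rule ennreal_suminf_lessD[OF fin])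
  then have bc: "b j = ennreal (c j)" for j
    unfolding c_def by (simp add: less_top)
  have c0: "0 \<le> c j" for j unfolding c_def by simp
  have "summable c"
    using fin c0 by (intro summable_suminf_not_top) (auto simp: bc)
  \<comment> \<open>Since \<open>e\<close> may be infinite, a positive real number below it is
    chosen for the argument with real series.\<close>
  obtain r where r: "0 < r" "ennreal r < e"
  proof -
    obtain y where y: "0 < y" "y < e" using dense[OF e] by blast
    have "y < top" by (rule order_less_le_trans[OF y(2) top_greatest])
    then have "y = ennreal (enn2real y)" by simp
    with y \<open>y < top\<close> show ?thesis by (intro that[of "enn2real y"]) (auto simp: enn2real_positive_iff)
  qed
  from suminf_exist_split[OF r(1) \<open>summable c\<close>]
  obtain n where n: "norm (\<Sum>j. c (j + n)) < r" by auto
  have "(\<lambda>j. c (j + n)) sums (\<Sum>j. c (j + n))"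
    using \<open>summable c\<close> by (simp add: summable_sums)
  then have "(\<lambda>j. if j < n then 0 else c j) sums (\<Sum>j. c (j + n))"
    using sums_iff_shift[of "\<lambda>j. if j < n then 0 else c j" n "\<Sum>j. c (j + n)"] by simp
  then have "(\<Sum>j. ennreal (if j < n then 0 else c j)) = ennreal (\<Sum>j. c (j + n))"
    by (intro suminf_ennreal_eq) (use c0 in auto)
  also have "\<dots> \<le> ennreal r" using n by (intro ennreal_leI) auto
  also have "\<dots> < e" by (rule r)
  also have "(\<lambda>j. ennreal (if j < n then 0 else c j)) = (\<lambda>j. if j < n then 0 else b j)"
    by (auto simp: bc)
  finally show ?thesis by blast
qed

section \<open>Step functions over disjoint blocks: upper and lower estimates\<close>

text \<open>The last assumption is the decisive one: on each block the identity is an optimal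
  rearrangement up to the factor \<open>q\<close>. The shape of the blocks enters only when the
  locale is interpreted.\<close>

locale blocks = weight +
  fixes J :: "nat \<Rightarrow> real set" and q :: real
  assumes J_sets [measurable]: "J j \<in> sets lebesgue"
    and J_pos: "J j \<subseteq> {0<..}"
    and J_disj: "i \<noteq> j \<Longrightarrow> J i \<inter> J j = {}"
    and nu_J_pos: "0 < emeasure nu (J j)"
    and nu_J_fin: "emeasure nu (J j) < \<infinity>"
    and q_pos: "0 < q"
    and Gsup_J_le: "Gsup W p (indicator (J j)) \<le> ennreal q * emeasure nu (J j)"
begin

text \<open>For disjoint blocks at most one term of the series is nonzero at each point, so it
  converges for every coefficient sequence.\<close>

definition step :: "(nat \<Rightarrow> real) \<Rightarrow> real \<Rightarrow> real" where
  "step a t = (\<Sum>j. a j * indicator (J j) t)"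

lemma step_in: "t \<in> J j \<Longrightarrow> step a t = a j"
  using J_disj unfolding step_def
  by (subst suminf_finite[of "{j}"]) (auto simp: indicator_def)

lemma step_out: "(\<And>j. t \<notin> J j) \<Longrightarrow> step a t = 0"
  unfolding step_def by simp

lemma step_eqI:
  assumes "\<And>j. t \<in> J j \<Longrightarrow> g t = a j" and "(\<And>j. t \<notin> J j) \<Longrightarrow> g t = 0"
  shows "step a t = g t"
proof (cases "\<exists>j. t \<in> J j")
  case True
  then show ?thesis using assms(1) step_in by metis
next
  case False
  then show ?thesis using assms(2) step_out by metis
qed

lemma step_finite: "(\<Sum>j<n. a j * indicator (J j) t) = step (\<lambda>j. if j < n then a j else 0) t"
  unfolding step_def by (subst suminf_finite[of "{..<n}"]) auto

lemma step_linear: "step (\<lambda>j. r * a j + s * b j) t = r * step a t + s * step b t"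
  by (rule step_eqI[where g = "\<lambda>t. r * step a t + s * step b t"]) (simp_all add: step_in step_out)

lemma J_measurable_restrict:
  "(indicator (J j) :: real \<Rightarrow> real) \<in> borel_measurable (restrict_space lebesgue {0<..})"
  by (intro measurable_restrict_space1) auto

lemma step_measurable: "step a \<in> borel_measurable (restrict_space lebesgue {0<..})"
  unfolding step_def by (intro measurable_restrict_space1) measurable

text \<open>Disjointness makes the p-th power additive over the blocks.\<close>

lemma powr_step: "ennreal (\<bar>step a t\<bar> powr p) = (\<Sum>j. ennreal (\<bar>a j\<bar> powr p) * indicator (J j) t)"
proof (cases "\<exists>j. t \<in> J j")
  case True
  then obtain j where j: "t \<in> J j" by blast
  then show ?thesis
    using J_disj by (subst suminf_finite[of "{j}"]) (auto simp: step_in indicator_def)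
next
  case False
  then show ?thesis by (simp add: step_out)
qed

text \<open>The upper estimate: for a fixed rearrangement the integral splits over the blocks, and
  each piece is at most its own supremum. Infinitely many coefficients are allowed because the
  projection produces them.\<close>

lemma Gsup_step_le:
  "Gsup W p (step a) \<le> (\<Sum>j. ennreal (\<bar>a j\<bar> powr p) * Gsup W p (indicator (J j)))"
proof (rule Gsup_le[OF step_measurable])
  fix E F m assume m: "m \<in> MO E F" "E \<in> Lam" "F \<in> Lam"
  note [measurable] = pull_measurable[OF m J_measurable_restrict]
  have eq: "ennreal (\<bar>pull m E (step a) t\<bar> powr p)
      = (\<Sum>j. ennreal (\<bar>a j\<bar> powr p) * ennreal (\<bar>pull m E (indicator (J j)) t\<bar> powr p))" for t
  proof (cases "t \<in> E")
    case True
    have "ennreal (\<bar>indicator (J j) (m t) :: real\<bar> powr p) = indicator (J j) (m t)" for j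
      using p_ge_1 by (simp add: indicator_def)
    then show ?thesis using True powr_step[of a "m t"] by (simp add: pull_def)
  qed (simp add: pull_def)
  have "(\<integral>\<^sup>+ t. ennreal (\<bar>pull m E (step a) t\<bar> powr p) \<partial>nu)
    = (\<Sum>j. \<integral>\<^sup>+ t. ennreal (\<bar>a j\<bar> powr p) * ennreal (\<bar>pull m E (indicator (J j)) t\<bar> powr p) \<partial>nu)"
    unfolding eq by (rule nn_integral_suminf) measurable
  also have "\<dots> = (\<Sum>j. ennreal (\<bar>a j\<bar> powr p) * (\<integral>\<^sup>+ t. ennreal (\<bar>pull m E (indicator (J j)) t\<bar> powr p) \<partial>nu))"
    by (subst nn_integral_cmult) measurable
  also have "\<dots> \<le> (\<Sum>j. ennreal (\<bar>a j\<bar> powr p) * Gsup W p (indicator (J j)))"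
    by (intro suminf_le mult_left_mono pull_le_Gsup[OF m J_measurable_restrict]) auto
  finally show "(\<integral>\<^sup>+ t. ennreal (\<bar>pull m E (step a) t\<bar> powr p) \<partial>nu)
    \<le> (\<Sum>j. ennreal (\<bar>a j\<bar> powr p) * Gsup W p (indicator (J j)))" .
qed

text \<open>The identity rearrangement combined with disjointness of the blocks. It is stated for
  general \<open>f\<close> because it serves both the lower estimate for steps and the bound for
  averages.\<close>

lemma sum_nn_integral_J_le:
  assumes f: "f \<in> borel_measurable (restrict_space lebesgue {0<..})"
  shows "(\<Sum>j. \<integral>\<^sup>+ t\<in>J j. ennreal (\<bar>f t\<bar> powr p) \<partial>nu) \<le> Gsup W p f"
proof -
  have [measurable]: "(\<lambda>t. ennreal (\<bar>f t\<bar> powr p) * indicator {0<..} t) \<in> borel_measurable lebesgue"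
    using f by (subst borel_measurable_restrict_space_iff_ennreal[symmetric]) auto
  have eq: "ennreal (\<bar>f t\<bar> powr p) * indicator (J j) t
      = ennreal (\<bar>f t\<bar> powr p) * indicator {0<..} t * indicator (J j) t" for j t
    using J_pos[of j] by (auto simp: indicator_def)
  have "(\<Sum>j. \<integral>\<^sup>+ t\<in>J j. ennreal (\<bar>f t\<bar> powr p) \<partial>nu)
     = (\<integral>\<^sup>+ t. (\<Sum>j. ennreal (\<bar>f t\<bar> powr p) * indicator (J j) t) \<partial>nu)"
    unfolding eq by (rule nn_integral_suminf[symmetric]) measurable
  also have "\<dots> \<le> (\<integral>\<^sup>+ t\<in>{0<..}. ennreal (\<bar>f t\<bar> powr p) \<partial>nu)"
  proof (rule nn_integral_mono)
    fix t
    show "(\<Sum>j. ennreal (\<bar>f t\<bar> powr p) * indicator (J j) t) \<le> ennreal (\<bar>f t\<bar> powr p) * indicator {0<..} t"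
    proof (cases "\<exists>j. t \<in> J j")
      case True
      then obtain j where j: "t \<in> J j" by blast
      then have "0 < t" using J_pos by auto
      then show ?thesis
        using J_disj j by (subst suminf_finite[of "{j}"]) (auto simp: indicator_def)
    qed simp
  qed
  also have "\<dots> \<le> Gsup W p f" by (rule nn_integral_le_Gsup[OF f])
  finally show ?thesis .
qed

text \<open>The lower estimate: at the cost of \<open>q\<close>, the supremum for each block is
  replaced by its \<open>nu\<close>-mass, and these masses recombine to an integral of the step
  function itself.\<close>

lemma sum_le_Gsup_step:
  "(\<Sum>j. ennreal (\<bar>a j\<bar> powr p) * Gsup W p (indicator (J j))) \<le> ennreal q * Gsup W p (step a)"
proof -
  have "(\<Sum>j. ennreal (\<bar>a j\<bar> powr p) * Gsup W p (indicator (J j)))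
     \<le> (\<Sum>j. ennreal (\<bar>a j\<bar> powr p) * (ennreal q * emeasure nu (J j)))"
    by (intro suminf_le mult_left_mono Gsup_J_le) auto
  also have "\<dots> = ennreal q * (\<Sum>j. ennreal (\<bar>a j\<bar> powr p) * emeasure nu (J j))"
    by (simp add: mult.left_commute)
  also have "(\<Sum>j. ennreal (\<bar>a j\<bar> powr p) * emeasure nu (J j))
     = (\<Sum>j. \<integral>\<^sup>+ t. ennreal (\<bar>a j\<bar> powr p) * indicator (J j) t \<partial>nu)"
    by (simp add: nn_integral_cmult_indicator)
  also have "\<dots> = (\<Sum>j. \<integral>\<^sup>+ t\<in>J j. ennreal (\<bar>step a t\<bar> powr p) \<partial>nu)"
    by (intro suminf_cong nn_integral_cong) (auto simp: indicator_def step_in)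
  also have "ennreal q * \<dots> \<le> ennreal q * Gsup W p (step a)"
    by (intro mult_left_mono sum_nn_integral_J_le step_measurable) simp
  finally show ?thesis .
qed

section \<open>The averaging projection\<close>

definition avg :: "(real \<Rightarrow> real) \<Rightarrow> nat \<Rightarrow> real" where
  "avg f j = (LINT t:J j|nu. f t) / measure nu (J j)"

lemma measure_nu_J_pos: "0 < measure nu (J j)"
  using nu_J_pos[of j] nu_J_fin[of j] by (simp add: measure_def enn2real_positive_iff)

text \<open>Integrability of the p-th power follows from the identity rearrangement. That of
  \<open>f\<close> follows from \<open>\<bar>f t\<bar> \<le> \<bar>f t\<bar> powr p + 1\<close>, as
  a block has finite mass.\<close>

lemma Gspace_integrable:
  assumes f: "f \<in> Gspace W p"
  shows "set_integrable nu (J j) (\<lambda>t. \<bar>f t\<bar> powr p)" and "set_integrable nu (J j) f"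
proof -
  have fm: "f \<in> borel_measurable (restrict_space lebesgue {0<..})" and fin: "Gsup W p f < \<infinity>"
    using f unfolding Gspace_def by auto
  \<comment> \<open>Measurability of \<open>f\<close> is known only on the positive half-line, so
    \<open>f\<close> is cut off there before being restricted to the block.\<close>
  have "(\<lambda>t. indicator {0<..} t *\<^sub>R f t) \<in> borel_measurable lebesgue"
    using fm by (subst borel_measurable_restrict_space_iff[symmetric]) auto
  then have "(\<lambda>t. indicator (J j) t * (indicator {0<..} t *\<^sub>R f t)) \<in> borel_measurable lebesgue"
    by measurable
  also have "(\<lambda>t. indicator (J j) t * (indicator {0<..} t *\<^sub>R f t)) = (\<lambda>t. indicator (J j) t * f t)"
    using J_pos[of j] by (auto simp: indicator_def fun_eq_iff)
  finally have fJ [measurable]: "(\<lambda>t. indicator (J j) t * f t) \<in> borel_measurable lebesgue" .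
  have powr_eq: "(\<lambda>t. indicator (J j) t * \<bar>f t\<bar> powr p) = (\<lambda>t. \<bar>indicator (J j) t * f t\<bar> powr p)"
    using p_ge_1 by (auto simp: indicator_def)
  have [measurable]: "(\<lambda>t. indicator (J j) t * \<bar>f t\<bar> powr p) \<in> borel_measurable lebesgue"
    unfolding powr_eq by measurable
  have "(\<integral>\<^sup>+ t. ennreal (norm (indicator (J j) t * \<bar>f t\<bar> powr p)) \<partial>nu)
      = (\<integral>\<^sup>+ t\<in>J j. ennreal (\<bar>f t\<bar> powr p) \<partial>nu)"
    by (intro nn_integral_cong) (auto simp: indicator_def)
  also have "\<dots> \<le> (\<integral>\<^sup>+ t\<in>{0<..}. ennreal (\<bar>f t\<bar> powr p) \<partial>nu)"
    using J_pos[of j] by (intro nn_integral_mono) (auto simp: indicator_def)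
  also have "\<dots> < \<infinity>"
    using nn_integral_le_Gsup[OF fm] fin by (rule order_le_less_trans)
  finally show fp: "set_integrable nu (J j) (\<lambda>t. \<bar>f t\<bar> powr p)"
    unfolding set_integrable_def by (intro integrableI_bounded) (simp_all add: measurable_cong_sets[OF sets_nu refl])
  have one: "set_integrable nu (J j) (\<lambda>t. 1::real)"
    using nu_J_fin[of j] by (simp add: set_integrable_def)
  have le: "\<bar>f t\<bar> \<le> \<bar>f t\<bar> powr p + 1" for t
  proof (cases "\<bar>f t\<bar> \<le> 1")
    case False
    then have "\<bar>f t\<bar> powr 1 \<le> \<bar>f t\<bar> powr p" by (intro powr_mono) (use p_ge_1 in auto)
    then show ?thesis using False by simp
  qed (simp add: add_increasing)
  show "set_integrable nu (J j) f"
    unfolding set_integrable_def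
  proof (rule Bochner_Integration.integrable_bound)
    show "integrable nu (\<lambda>t. indicator (J j) t *\<^sub>R (\<bar>f t\<bar> powr p + 1))"
      using set_integral_add(1)[OF fp one] unfolding set_integrable_def .
    show "(\<lambda>t. indicator (J j) t *\<^sub>R f t) \<in> borel_measurable nu"
      using fJ by (simp add: measurable_cong_sets[OF sets_nu refl])
    have "norm (indicator (J j) t *\<^sub>R f t) \<le> norm (indicator (J j) t *\<^sub>R (\<bar>f t\<bar> powr p + 1))" for t
      using le[of t] by (cases "t \<in> J j") simp_all
    then show "AE t in nu. norm (indicator (J j) t *\<^sub>R f t)
        \<le> norm (indicator (J j) t *\<^sub>R (\<bar>f t\<bar> powr p + 1))" by blast
  qed
qed

lemma avg_step: "avg (step a) = a"
proof
  fix j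
  have "(LINT t:J j|nu. step a t) = (LINT t:J j|nu. a j)"
    by (intro set_lebesgue_integral_cong) (auto simp: step_in)
  also have "\<dots> = a j * measure nu (J j)"
    using nu_J_fin[of j] by (simp add: set_lebesgue_integral_def)
  finally show "avg (step a) j = a j"
    using measure_nu_J_pos[of j] unfolding avg_def by simp
qed

lemma avg_linear:
  assumes "f \<in> Gspace W p" "g \<in> Gspace W p"
  shows "avg (\<lambda>t. r * f t + s * g t) j = r * avg f j + s * avg g j"
  using Gspace_integrable(2)[OF assms(1), of j] Gspace_integrable(2)[OF assms(2), of j]
  unfolding avg_def by (simp add: add_divide_distrib)

lemma avg_powr_le:
  assumes f: "f \<in> Gspace W p"
  shows "ennreal (\<bar>avg f j\<bar> powr p) * emeasure nu (J j) \<le> (\<integral>\<^sup>+ t\<in>J j. ennreal (\<bar>f t\<bar> powr p) \<partial>nu)"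
proof -
  have "ennreal (\<bar>avg f j\<bar> powr p) * emeasure nu (J j) = ennreal (\<bar>avg f j\<bar> powr p * measure nu (J j))"
    using nu_J_fin[of j] by (simp add: emeasure_eq_ennreal_measure ennreal_mult)
  also have "\<dots> \<le> ennreal (LINT t:J j|nu. \<bar>f t\<bar> powr p)"
    unfolding avg_def
    by (intro ennreal_leI average_powr_le p_ge_1 nu_J_fin measure_nu_J_pos Gspace_integrable f) simp
  also have "\<dots> = (\<integral>\<^sup>+ t. ennreal (indicator (J j) t * \<bar>f t\<bar> powr p) \<partial>nu)"
    using Gspace_integrable(1)[OF f, of j] unfolding set_lebesgue_integral_def set_integrable_def
    by (subst nn_integral_eq_integral) auto
  also have "\<dots> = (\<integral>\<^sup>+ t\<in>J j. ennreal (\<bar>f t\<bar> powr p) \<partial>nu)"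
    by (intro nn_integral_cong) (auto simp: indicator_def)
  finally show ?thesis .
qed

text \<open>Jensen on each block, between the two comparisons already used for step functions.
  Besides bounding the projection, this gives the convergence that lets finite partial sums
  approximate \<open>proj f\<close>.\<close>

lemma sum_avg_le:
  assumes f: "f \<in> Gspace W p"
  shows "(\<Sum>j. ennreal (\<bar>avg f j\<bar> powr p) * Gsup W p (indicator (J j))) \<le> ennreal q * Gsup W p f"
proof -
  have "(\<Sum>j. ennreal (\<bar>avg f j\<bar> powr p) * Gsup W p (indicator (J j)))
     \<le> (\<Sum>j. ennreal (\<bar>avg f j\<bar> powr p) * (ennreal q * emeasure nu (J j)))"
    by (intro suminf_le mult_left_mono Gsup_J_le) auto
  also have "\<dots> = ennreal q * (\<Sum>j. ennreal (\<bar>avg f j\<bar> powr p) * emeasure nu (J j))"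
    by (simp add: mult.left_commute)
  also have "\<dots> \<le> ennreal q * (\<Sum>j. \<integral>\<^sup>+ t\<in>J j. ennreal (\<bar>f t\<bar> powr p) \<partial>nu)"
    by (intro mult_left_mono suminf_le avg_powr_le f) auto
  also have "\<dots> \<le> ennreal q * Gsup W p f"
    using f by (intro mult_left_mono sum_nn_integral_J_le) (auto simp: Gspace_def)
  finally show ?thesis .
qed

definition proj :: "(real \<Rightarrow> real) \<Rightarrow> real \<Rightarrow> real" where
  "proj f = step (avg f)"

lemma Gsup_proj_le: "f \<in> Gspace W p \<Longrightarrow> Gsup W p (proj f) \<le> ennreal q * Gsup W p f"
  unfolding proj_def using Gsup_step_le sum_avg_le order_trans by blast

lemma proj_in_Gspace: "f \<in> Gspace W p \<Longrightarrow> proj f \<in> Gspace W p"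
proof -
  assume f: "f \<in> Gspace W p"
  then have "ennreal q * Gsup W p f < \<infinity>"
    by (simp add: Gspace_def ennreal_mult_less_top)
  with Gsup_proj_le[OF f] have "Gsup W p (proj f) < \<infinity>" by (rule order_le_less_trans)
  then show ?thesis using step_measurable by (simp add: Gspace_def proj_def)
qed

lemma proj_linear:
  assumes "f \<in> Gspace W p" "g \<in> Gspace W p"
  shows "proj (\<lambda>t. r * f t + s * g t) t = r * proj f t + s * proj g t"
  unfolding proj_def avg_linear[OF assms] by (rule step_linear)

lemma proj_step: "proj (step a) = step a"
  unfolding proj_def by (simp add: avg_step)

section \<open>Normalized blocks and their equivalence with the \<open>\<ell>\<^sub>p\<close>
  basis\<close>

abbreviation G :: "nat \<Rightarrow> real" where
  "G j \<equiv> Gnorm W p (indicator (J j))"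

lemma Gsup_J_fin: "Gsup W p (indicator (J j)) < \<infinity>"
proof -
  have "ennreal q * emeasure nu (J j) < \<infinity>"
    using nu_J_fin[of j] by (simp add: ennreal_mult_less_top)
  with Gsup_J_le show ?thesis by (rule order_le_less_trans)
qed

lemma G_powr: "ennreal (G j powr p) = Gsup W p (indicator (J j))"
  by (rule Gnorm_powr[OF Gsup_J_fin])

lemma G_pos: "0 < G j"
proof -
  have "0 < emeasure nu (J j)" by (rule nu_J_pos)
  also have "emeasure nu (J j) = (\<integral>\<^sup>+ t. indicator (J j) t \<partial>nu)" by simp
  also have "\<dots> = (\<integral>\<^sup>+ t\<in>{0<..}. ennreal (\<bar>indicator (J j) t\<bar> powr p) \<partial>nu)"
    using p_ge_1 J_pos[of j] by (intro nn_integral_cong) (auto simp: indicator_def)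
  also have "\<dots> \<le> Gsup W p (indicator (J j))"
    by (rule nn_integral_le_Gsup[OF J_measurable_restrict])
  also have "\<dots> = ennreal (G j powr p)" by (rule G_powr[symmetric])
  finally have "0 < G j powr p" by simp
  moreover have "0 \<le> G j" unfolding Gnorm_def by simp
  ultimately show ?thesis by (cases "G j = 0") auto
qed

lemma normalized_sum:
  "(\<Sum>j<n. a j * (indicator (J j) t / G j)) = step (\<lambda>j. if j < n then a j / G j else 0) t"
  using step_finite[of "\<lambda>j. a j / G j" _ n] by simp

lemma step_finite_in_Gspace: "step (\<lambda>j. if j < n then a j else 0) \<in> Gspace W p"
proof -
  have "(\<Sum>j. ennreal (\<bar>if j < n then a j else 0\<bar> powr p) * Gsup W p (indicator (J j)))
    = (\<Sum>j<n. ennreal (\<bar>if j < n then a j else 0\<bar> powr p) * Gsup W p (indicator (J j)))"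
    by (rule suminf_finite) auto
  also have "\<dots> < \<infinity>"
    using Gsup_J_fin by (auto simp: ennreal_mult_less_top)
  finally have "Gsup W p (step (\<lambda>j. if j < n then a j else 0)) < \<infinity>"
    by (rule order_le_less_trans[OF Gsup_step_le])
  then show ?thesis using step_measurable by (simp add: Gspace_def)
qed

lemma Gspace_diff:
  assumes "f \<in> Gspace W p" "g \<in> Gspace W p"
  shows "(\<lambda>t. f t - g t) \<in> Gspace W p"
proof -
  have f: "f \<in> borel_measurable (restrict_space lebesgue {0<..})" "Gsup W p f < \<infinity>"
    and g: "g \<in> borel_measurable (restrict_space lebesgue {0<..})" "Gsup W p g < \<infinity>"
    using assms unfolding Gspace_def by auto
  have mg: "(\<lambda>t. - 1 * g t) \<in> borel_measurable (restrict_space lebesgue {0<..})"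
    using g(1) by measurable
  have "Gsup W p (\<lambda>t. - 1 * g t) < \<infinity>"
    using Gsup_cmult[OF g(1), of "- 1"] g(2) by (simp add: order_le_less_trans)
  then have "ennreal (2 powr p) * (Gsup W p f + Gsup W p (\<lambda>t. - 1 * g t)) < \<infinity>"
    using f(2) by (simp add: ennreal_mult_less_top)
  with Gsup_add_le[OF f(1) mg] have "Gsup W p (\<lambda>t. f t + - 1 * g t) < \<infinity>"
    by (rule order_le_less_trans)
  then show ?thesis using f(1) g(1) unfolding Gspace_def by simp
qed

text \<open>The whole constant sits in the lower estimate; the upper one has constant 1.\<close>

lemma lp_equiv_blocks:
  "lp_equiv W p (\<lambda>j t. indicator (J j) t / G j) (q powr (1 / p))"
proof -
  have "(1 / q powr (1 / p)) * (\<Sum>j<n. \<bar>a j\<bar> powr p) powr (1 / p)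
          \<le> Gnorm W p (\<lambda>t. \<Sum>j<n. a j * (indicator (J j) t / G j)) \<and>
        Gnorm W p (\<lambda>t. \<Sum>j<n. a j * (indicator (J j) t / G j))
          \<le> 1 * (\<Sum>j<n. \<bar>a j\<bar> powr p) powr (1 / p)" for n and a :: "nat \<Rightarrow> real"
  proof -
    define b where "b j = (if j < n then a j / G j else 0)" for j
    define S where "S = (\<Sum>j<n. \<bar>a j\<bar> powr p)"
    have S0: "0 \<le> S" unfolding S_def by (intro sum_nonneg) simp
    have f: "(\<lambda>t. \<Sum>j<n. a j * (indicator (J j) t / G j)) = step b"
      unfolding normalized_sum b_def by simp
    \<comment> \<open>Normalization cancels the supremum of each block, so both estimates turn into
      statements about \<open>S\<close>.\<close>
    have term_eq: "ennreal (\<bar>a j / G j\<bar> powr p) * Gsup W p (indicator (J j)) = ennreal (\<bar>a j\<bar> powr p)" for j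
      using G_pos[of j]
      by (simp add: G_powr[symmetric] powr_divide abs_divide flip: ennreal_mult)
    have "(\<Sum>j. ennreal (\<bar>b j\<bar> powr p) * Gsup W p (indicator (J j)))
       = (\<Sum>j<n. ennreal (\<bar>b j\<bar> powr p) * Gsup W p (indicator (J j)))"
      by (rule suminf_finite) (auto simp: b_def)
    also have "\<dots> = (\<Sum>j<n. ennreal (\<bar>a j\<bar> powr p))"
      by (intro sum.cong refl) (simp only: b_def lessThan_iff if_True term_eq)
    also have "\<dots> = ennreal S" unfolding S_def by (rule sum_ennreal) simp
    finally have S: "(\<Sum>j. ennreal (\<bar>b j\<bar> powr p) * Gsup W p (indicator (J j))) = ennreal S" .
    have up: "Gsup W p (step b) \<le> ennreal S" using Gsup_step_le[of b] S by simp
    have lo: "ennreal S \<le> ennreal q * Gsup W p (step b)" using sum_le_Gsup_step[of b] S by simp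
    define g where "g = enn2real (Gsup W p (step b))"
    have g: "Gsup W p (step b) = ennreal g" "0 \<le> g"
      using order_le_less_trans[OF up ennreal_less_top] unfolding g_def by simp_all
    have "g \<le> S" using up S0 g by simp
    then have 1: "g powr (1 / p) \<le> S powr (1 / p)"
      using g p_ge_1 by (intro powr_mono2) auto
    have "S \<le> q * g" using lo S0 g q_pos by (simp flip: ennreal_mult)
    then have "S powr (1 / p) \<le> (q * g) powr (1 / p)"
      using S0 p_ge_1 by (intro powr_mono2) auto
    then have 2: "S powr (1 / p) \<le> q powr (1 / p) * g powr (1 / p)"
      by (simp add: powr_mult)
    have "Gnorm W p (step b) = g powr (1 / p)"
      by (simp add: Gnorm_def g_def)
    then show ?thesis
      unfolding f S_def[symmetric] using 1 2 q_pos by (simp add: field_simps)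
  qed
  then show ?thesis
    unfolding lp_equiv_def using q_pos
    by (intro exI[of _ "q powr (1 / p)"] exI[of _ 1]) auto
qed

section \<open>The projection onto the closed span\<close>

lemma Gnorm_proj_le:
  assumes f: "f \<in> Gspace W p"
  shows "Gnorm W p (proj f) \<le> q powr (1 / p) * Gnorm W p f"
proof -
  have fin: "ennreal q * Gsup W p f < \<infinity>"
    using f by (simp add: Gspace_def ennreal_mult_less_top)
  have "enn2real (Gsup W p (proj f)) \<le> enn2real (ennreal q * Gsup W p f)"
    using Gsup_proj_le[OF f] fin by (intro enn2real_mono) auto
  also have "\<dots> = q * enn2real (Gsup W p f)"
    using q_pos by (simp add: enn2real_mult)
  finally have "enn2real (Gsup W p (proj f)) powr (1 / p) \<le> (q * enn2real (Gsup W p f)) powr (1 / p)"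
    using p_ge_1 by (intro powr_mono2) auto
  then show ?thesis by (simp add: Gnorm_def powr_mult)
qed

text \<open>Subtracting the first \<open>n\<close> blocks from \<open>proj f\<close> leaves the step
  function of the remaining averages. By the upper estimate it is bounded by a tail of the
  convergent series from \<open>sum_avg_le\<close>.\<close>

lemma proj_in_Gclspan:
  assumes f: "f \<in> Gspace W p"
  shows "proj f \<in> Gclspan W p (\<lambda>j t. indicator (J j) t / G j)"
proof -
  have "\<exists>n c. Gnorm W p (\<lambda>t. proj f t - (\<Sum>j<n. c j * (indicator (J j) t / G j))) < e"
    if e: "0 < e" for e :: real
  proof -
    let ?b = "\<lambda>j. ennreal (\<bar>avg f j\<bar> powr p) * Gsup W p (indicator (J j))"
    have "ennreal q * Gsup W p f < \<infinity>"
      using f by (simp add: Gspace_def ennreal_mult_less_top)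
    with sum_avg_le[OF f] have "(\<Sum>j. ?b j) < \<infinity>" by (rule order_le_less_trans)
    moreover have "0 < ennreal (e powr p)" using e by simp
    ultimately obtain n where n: "(\<Sum>j. if j < n then 0 else ?b j) < ennreal (e powr p)"
      using ennreal_suminf_tail_less by blast
    define a where "a j = (if j < n then 0 else avg f j)" for j
    \<comment> \<open>The factor \<open>G j\<close> in the coefficients undoes the normalization of
      the blocks.\<close>
    have eq: "(\<lambda>t. proj f t - (\<Sum>j<n. (avg f j * G j) * (indicator (J j) t / G j))) = step a"
    proof
      fix t
      show "proj f t - (\<Sum>j<n. (avg f j * G j) * (indicator (J j) t / G j)) = step a t"
        unfolding normalized_sum proj_def
        by (rule step_eqI[symmetric]) (use G_pos in \<open>auto simp: step_in step_out a_def less_imp_neq[symmetric]\<close>)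
    qed
    have "Gsup W p (step a) \<le> (\<Sum>j. ennreal (\<bar>a j\<bar> powr p) * Gsup W p (indicator (J j)))"
      by (rule Gsup_step_le)
    also have "\<dots> = (\<Sum>j. if j < n then 0 else ?b j)"
      by (intro suminf_cong) (simp add: a_def)
    also note n
    finally have less: "Gsup W p (step a) < ennreal (e powr p)" .
    then have "enn2real (Gsup W p (step a)) < e powr p"
      using less_trans[OF less ennreal_less_top] by (cases "Gsup W p (step a)") (simp_all add: ennreal_less_iff)
    then have "Gnorm W p (step a) < (e powr p) powr (1 / p)"
      unfolding Gnorm_def using p_ge_1 by (intro powr_less_mono2) auto
    also have "\<dots> = e" using e p_ge_1 by (simp add: powr_powr)
    finally show ?thesis using eq by (intro exI[of _ n] exI[of _ "\<lambda>j. avg f j * G j"]) simp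
  qed
  then show ?thesis using proj_in_Gspace[OF f] unfolding Gclspan_def by auto
qed

text \<open>The projection fixes every finite combination \<open>s\<close>, so
  \<open>proj f - f\<close> equals \<open>proj (f - s) - (f - s)\<close> and is controlled by the
  arbitrarily small \<open>f - s\<close>.\<close>

lemma Gnorm_proj_diff:
  assumes f: "f \<in> Gclspan W p (\<lambda>j t. indicator (J j) t / G j)"
  shows "Gnorm W p (\<lambda>t. proj f t - f t) = 0"
proof -
  have fG: "f \<in> Gspace W p" using f unfolding Gclspan_def by auto
  \<comment> \<open>Here \<open>2 powr p\<close> is the cost of adding two functions,
    \<open>q\<close> comes from the projected difference and 1 from the difference itself.\<close>
  define K where "K = 2 powr p * (q + 1)"
  have K: "0 < K" using q_pos unfolding K_def by simp
  have le: "Gsup W p (\<lambda>t. proj f t - f t) \<le> ennreal (K * e)" if e: "0 < e" for e :: real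
  proof -
    \<comment> \<open>Approximation in norm up to this root makes \<open>Gsup\<close> of the
      difference at most \<open>e\<close>.\<close>
    have "0 < e powr (1 / p)" using e by simp
    with f obtain n c where nc: "Gnorm W p (\<lambda>t. f t - (\<Sum>j<n. c j * (indicator (J j) t / G j))) < e powr (1 / p)"
      unfolding Gclspan_def by blast
    define s where "s = step (\<lambda>j. if j < n then c j / G j else 0)"
    have s: "Gnorm W p (\<lambda>t. f t - s t) < e powr (1 / p)"
      using nc unfolding normalized_sum s_def .
    have sG: "s \<in> Gspace W p" unfolding s_def by (rule step_finite_in_Gspace)
    have ps: "proj s = s" unfolding s_def by (rule proj_step)
    have d: "(\<lambda>t. f t - s t) \<in> Gspace W p" by (rule Gspace_diff[OF fG sG])
    have d': "(\<lambda>t. - 1 * (f t - s t)) \<in> borel_measurable (restrict_space lebesgue {0<..})"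
      using d unfolding Gspace_def by (intro borel_measurable_times borel_measurable_const) auto
    have small: "Gsup W p (\<lambda>t. f t - s t) \<le> ennreal e"
    proof -
      have "Gnorm W p (\<lambda>t. f t - s t) powr p \<le> (e powr (1 / p)) powr p"
        using s p_ge_1 by (intro powr_mono2) (auto simp: Gnorm_def)
      also have "\<dots> = e" using e p_ge_1 by (simp add: powr_powr)
      finally have "ennreal (Gnorm W p (\<lambda>t. f t - s t) powr p) \<le> ennreal e" by (rule ennreal_leI)
      then show ?thesis using Gnorm_powr[of "\<lambda>t. f t - s t"] d by (simp add: Gspace_def)
    qed
    have "proj f t - f t = proj (\<lambda>t. f t - s t) t + - 1 * (f t - s t)" for t
      using proj_linear[OF fG sG, of 1 "- 1" t] ps by simp
    then have "Gsup W p (\<lambda>t. proj f t - f t)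
       = Gsup W p (\<lambda>t. proj (\<lambda>t. f t - s t) t + - 1 * (f t - s t))"
      by (intro arg_cong[of _ _ "Gsup W p"] ext)
    also have "\<dots> \<le> ennreal (2 powr p) * (Gsup W p (proj (\<lambda>t. f t - s t)) + Gsup W p (\<lambda>t. - 1 * (f t - s t)))"
      using proj_in_Gspace[OF d] d' by (intro Gsup_add_le) (auto simp: Gspace_def)
    also have "\<dots> \<le> ennreal (2 powr p) * (ennreal q * Gsup W p (\<lambda>t. f t - s t) + ennreal (\<bar>- 1\<bar> powr p) * Gsup W p (\<lambda>t. f t - s t))"
      using d by (intro mult_left_mono add_mono Gsup_proj_le Gsup_cmult) (auto simp: Gspace_def)
    also have "\<dots> \<le> ennreal (2 powr p) * (ennreal q * ennreal e + ennreal (\<bar>- 1\<bar> powr p) * ennreal e)"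
      by (intro mult_left_mono add_mono small) auto
    also have "\<dots> = ennreal (K * e)"
      using q_pos e by (simp add: K_def algebra_simps flip: ennreal_mult ennreal_plus)
    finally show ?thesis .
  qed
  have "Gsup W p (\<lambda>t. proj f t - f t) \<le> 0 + ennreal r" if "0 < r" for r
    using le[of "r / K"] that K by simp
  then have "Gsup W p (\<lambda>t. proj f t - f t) \<le> 0"
    by (rule ennreal_le_epsilon)
  then show ?thesis by (simp add: Gnorm_def)
qed

lemma Gcomplemented_blocks:
  assumes "X \<subseteq> Gspace W p"
  shows "Gcomplemented W p (Gclspan W p (\<lambda>j t. indicator (J j) t / G j)) X (q powr (1 / p))"
proof -
  \<comment> \<open>\<open>proj\<close> is linear pointwise on the space, so the linearity clause is
    about the norm of the zero function.\<close>
  have zero: "Gnorm W p (\<lambda>t. 0) = 0"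
    using Gsup_cmult[of "\<lambda>t. 0" 0] p_ge_1 by (simp add: Gnorm_def)
  show ?thesis
    unfolding Gcomplemented_def
  proof (intro exI[of _ proj] conjI ballI allI)
    fix f g a b assume f: "f \<in> X" and g: "g \<in> X"
    then have "f \<in> Gspace W p" "g \<in> Gspace W p" using assms by auto
    then show "Gnorm W p (\<lambda>t. proj (\<lambda>s. a * f s + b * g s) t - (a * proj f t + b * proj g t)) = 0"
      by (simp add: proj_linear zero)
  next
    fix f assume "f \<in> X"
    then have "f \<in> Gspace W p" using assms by auto
    then show "proj f \<in> Gclspan W p (\<lambda>j t. indicator (J j) t / G j)"
      and "Gnorm W p (proj f) \<le> q powr (1 / p) * Gnorm W p f"
      by (rule proj_in_Gclspan, rule Gnorm_proj_le)
  qed (rule Gnorm_proj_diff)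
qed

end

section \<open>Choice of the blocks and conclusion\<close>

text \<open>Adjacent half-open intervals glue together. Both endpoints are one less than the indices
  because \<open>unitind n\<close> occupies the unit interval that ends at \<open>n\<close>.\<close>

lemma sum_unitind:
  assumes "1 \<le> a" "a \<le> b"
  shows "(\<Sum>n\<in>{a..<b}. unitind n t) = indicator {real a - 1<..real b - 1} t"
  using assms(2)
proof (induction b rule: dec_induct)
  case (step n)
  then show ?case by (auto simp: unitind_def indicator_def)
qed simp

lemma lp_equiv_mono: "lp_equiv W p x C \<Longrightarrow> C \<le> C' \<Longrightarrow> lp_equiv W p x C'"
  unfolding lp_equiv_def by (meson order_trans)

lemma Gcomplemented_mono:
  assumes "Gcomplemented W p Y X K" "K \<le> K'"
  shows "Gcomplemented W p Y X K'"
proof -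
  have "K * Gnorm W p f \<le> K' * Gnorm W p f" for f
    using assms(2) by (intro mult_right_mono) (auto simp: Gnorm_def)
  then have "Gnorm W p (P f) \<le> K' * Gnorm W p f" if "Gnorm W p (P f) \<le> K * Gnorm W p f" for P f
    using that order_trans by blast
  with assms(1) show ?thesis
    unfolding Gcomplemented_def by (elim exE conjE, intro exI conjI) auto
qed

theorem mainTheorem10:
  fixes p :: real and W :: "real \<Rightarrow> real" and \<epsilon> :: real
  assumes "1 \<le> p" and "W \<in> Wclass" and "\<epsilon> > 0"
  shows "\<exists>k :: nat \<Rightarrow> nat. strict_mono k \<and> k 0 = 1 \<and>
    (let u = (\<lambda>j t. \<Sum>n\<in>{k j..<k (Suc j)}. unitind n t);
         x = (\<lambda>j t. u j t / Gnorm W p (u j))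
     in lp_equiv W p x (1 + \<epsilon>)
        \<and> Gcomplemented W p (Gclspan W p x) (Gclspan W p (\<lambda>i. unitind (Suc i))) 2)"
proof -
  interpret weight p W using assms by unfold_locales
  \<comment> \<open>Capping at 1 lets one factor \<open>q powr (1 / p) = 1 + \<delta>\<close> be at
    most both \<open>1 + \<epsilon>\<close>, for the equivalence, and 2, for the projection.\<close>
  define \<delta> where "\<delta> = min \<epsilon> 1"
  have \<delta>: "0 < \<delta>" "\<delta> \<le> \<epsilon>" "\<delta> \<le> 1" using assms(3) unfolding \<delta>_def by auto
  define q where "q = (1 + \<delta>) powr p"
  have q: "1 < q" unfolding q_def using \<delta> assms(1) by (intro gr_one_powr) auto
  have root_q: "q powr (1 / p) = 1 + \<delta>"
    unfolding q_def using \<delta> assms(1) by (simp add: powr_powr)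
  \<comment> \<open>Dependent choice from 0 builds the endpoints: \<open>K (Suc j)\<close> lies so
    far beyond \<open>K j\<close> that the interval between them carries at least the fraction
    \<open>1 / q\<close> of all mass up to its right end.\<close>
  have "\<exists>K :: nat \<Rightarrow> nat. \<forall>j. (j = 0 \<longrightarrow> K j = 0) \<and> (K j < K (Suc j) \<and>
      emeasure nu {0<..real (K (Suc j))} \<le> ennreal q * emeasure nu {real (K j)<..real (K (Suc j))})"
    by (rule dependent_nat_choice) (use ex_dominating_interval[OF q] in auto)
  then obtain K :: "nat \<Rightarrow> nat" where K0: "K 0 = 0" and K: "K j < K (Suc j)"
    and Kq: "emeasure nu {0<..real (K (Suc j))} \<le> ennreal q * emeasure nu {real (K j)<..real (K (Suc j))}" for j
    by blast
  have mono: "strict_mono K" using K by (simp add: strict_mono_Suc_iff)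
  define J where "J j = {real (K j)<..real (K (Suc j))}" for j
  interpret blocks p W J q
  proof
    show "J i \<inter> J j = {}" if "i \<noteq> j" for i j
    proof -
      have "J i \<inter> J j = {}" if "i < j" for i j
      proof -
        have "K (Suc i) \<le> K j" using mono that by (simp add: strict_mono_less_eq)
        then show ?thesis unfolding J_def by auto
      qed
      then show ?thesis using that by (metis Int_commute nat_neq_iff)
    qed
    show "0 < emeasure nu (J j)" for j
      unfolding J_def using K by (intro nu_interval_pos) auto
    have "emeasure nu (J j) \<le> emeasure nu {0<..real (K (Suc j))}" for j
      unfolding J_def by (rule emeasure_mono) auto
    then show "emeasure nu (J j) < \<infinity>" for j
      using nu_interval_finite order_le_less_trans by blast
    show "Gsup W p (indicator (J j)) \<le> ennreal q * emeasure nu (J j)" for j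
    proof -
      \<comment> \<open>The block is compared with the initial interval up to its own right end,
        which is at least as long; this is the interval controlled by \<open>Kq\<close>.\<close>
      have "Gsup W p (indicator (J j)) \<le> emeasure nu {0<..real (K (Suc j))}"
        unfolding J_def using K[of j] by (intro Gsup_indicator_le) (auto intro!: ennreal_leI)
      then show ?thesis using Kq[of j] unfolding J_def by (rule order_trans)
    qed
  qed (use q in \<open>auto simp: J_def\<close>)
  \<comment> \<open>The shift makes the indices from \<open>k j\<close> to
    \<open>k (Suc j) - 1\<close> cover exactly \<open>J j\<close>, and turns \<open>K 0 = 0\<close>
    into \<open>k 0 = 1\<close>.\<close>
  define k where "k j = Suc (K j)" for j
  have u: "(\<lambda>j t. \<Sum>n\<in>{k j..<k (Suc j)}. unitind n t) = (\<lambda>j. indicator (J j))"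
    using K by (intro ext) (subst sum_unitind, auto simp: k_def J_def less_imp_le)
  have X: "Gclspan W p (\<lambda>i. unitind (Suc i)) \<subseteq> Gspace W p"
    unfolding Gclspan_def by auto
  have "lp_equiv W p (\<lambda>j t. indicator (J j) t / G j) (1 + \<epsilon>)"
    by (rule lp_equiv_mono[OF lp_equiv_blocks]) (use root_q \<delta> in simp)
  moreover have "Gcomplemented W p (Gclspan W p (\<lambda>j t. indicator (J j) t / G j))
      (Gclspan W p (\<lambda>i. unitind (Suc i))) 2"
    by (rule Gcomplemented_mono[OF Gcomplemented_blocks[OF X]]) (use root_q \<delta> in simp)
  moreover have "strict_mono k" "k 0 = 1"
    using mono K0 unfolding k_def strict_mono_def by auto
  ultimately show ?thesis
    by (intro exI[of _ k]) (simp only: u Let_def simp_thms)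
qed

end
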